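(* Let $\alpha \in (0,1)$ and let $\mathcal{E}$ be a finite or cofinite set of positive integers with $1 \in \mathcal{E}$. Then there exists a linear recurrence $\big\{\beta_j^{(\mathcal{E})}\big\}_{j=0}^\infty$ of real numbers, depending only on $\mathcal{E}$ and $\alpha$, such that, setting $$\gamma_i^{(\mathcal{E})} := \frac{\beta_{i-1}^{(\mathcal{E})}\,\beta_{i+1}^{(\mathcal{E})}}{\big(\beta_i^{(\mathcal{E})}\big)^2} \quad \text{for all integers } i \geq 1,$$ the following holds. For every positive integer $n$, if $\mathcal{A}$ is a random set in $\mathcal{B}(n,\alpha)$, then for all positive integers $r < s$ with $\gcd(r,s)=1$ we have $$\mathbb{P}\left(\bigvee_{e \in \mathcal{E}} \big((r/s)^e \in \mathcal{A}/\mathcal{A}\big)\right) = 1 - \prod_{i=1}^{\left\lfloor \frac{\log n}{\log s}\right\rfloor} \left(\gamma_i^{(\mathcal{E})}\right)^{\lfloor n/s^i \rfloor}.$$ In particular, if $\mathcal{E}$ is cofinite then $\gamma_i^{(\mathcal{E})}$ is a rational function of $i$ for all sufficiently large $i$ (that is, there is a rational function $R \in \mathbb{R}(X)$ such that $\gamma_i^{(\mathcal{E})} = R(i)$ for all sufficiently large integers $i$).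
   Context: For a positive integer $n$ and $\alpha \in (0,1)$, $\mathcal{B}(n,\alpha)$ denotes the probabilistic model in which a random set $\mathcal{A} \subseteq \{1,\dots,n\}$ is constructed by picking independently every element of $\{1,\dots,n\}$ with probability $\alpha$. The ratio set of $\mathcal{A}$ is $\mathcal{A}/\mathcal{A} := \{a/b : a,b \in \mathcal{A}\}$. The symbol $\bigvee_{e \in \mathcal{E}}$ denotes the union (logical "or") of the events, i.e. the event that $(r/s)^e \in \mathcal{A}/\mathcal{A}$ for some $e \in \mathcal{E}$. A set of positive integers is cofinite if its complement in the positive integers is finite. A sequence $\{\beta_j\}_{j=0}^\infty$ is a linear recurrence if there exist an integer $k \geq 1$ and constants $c_1,\dots,c_k$ such that $\beta_j = c_1\beta_{j-1} + \cdots + c_k\beta_{j-k}$ for all integers $j \geq k$ (the constant $c_k$ is allowed to be zero). "Depending only on $\mathcal{E}$ and $\alpha$" means that the sequence does not depend on $n$, $r$, $s$. An empty product equals $1$. *)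

theory Defs
  imports "HOL-Probability.Probability" "HOL-Probability.Product_PMF"
    "HOL-Computational_Algebra.Polynomial"
begin

definition random_subset_pmf :: "nat \<Rightarrow> real \<Rightarrow> nat set pmf" where
  "random_subset_pmf n \<alpha> =
     map_pmf (\<lambda>f. {x \<in> {1..n}. f x}) (Pi_pmf {1..n} False (\<lambda>_. bernoulli_pmf \<alpha>))"

text \<open>The sets of interest contain only positive integers, so no division by zero occurs here.\<close>

definition ratio_set :: "nat set \<Rightarrow> rat set" where
  "ratio_set A = {of_nat a / of_nat b | a b. a \<in> A \<and> b \<in> A}"

text \<open>The last constant \<open>c k\<close> is allowed to be zero.\<close>

definition linear_recurrence :: "(nat \<Rightarrow> real) \<Rightarrow> bool" where
  "linear_recurrence \<beta> \<longleftrightarrow>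
     (\<exists>k\<ge>1. \<exists>c :: nat \<Rightarrow> real. \<forall>j\<ge>k. \<beta> j = (\<Sum>i=1..k. c i * \<beta> (j - i)))"

text \<open>Only meaningful for \<open>i \<ge> 1\<close> (truncated subtraction) and \<open>\<beta> i \<noteq> 0\<close>.\<close>

definition gamma_seq :: "(nat \<Rightarrow> real) \<Rightarrow> nat \<Rightarrow> real" where
  "gamma_seq \<beta> i = \<beta> (i - 1) * \<beta> (i + 1) / (\<beta> i)\<^sup>2"

end

theory Submission imports Defs begin

text \<open>
  Let \<open>\<beta> j\<close> be the probability that a random subset of \<open>{1..j}\<close> has no two elements whose
  difference lies in \<open>E\<close>. The pairs with quotient a power of \<open>r / s\<close> split \<open>{1..n}\<close> into
  geometric chains, on which the complementary event becomes gap-freeness of the exponents. Passing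
  from \<open>n - 1\<close> to \<open>n\<close> lengthens only the chain ending in \<open>n\<close>, from \<open>v\<close> to \<open>v + 1\<close> elements
  where \<open>s ^ v\<close> is the largest power of \<open>s\<close> dividing \<open>n\<close>; this multiplies the probability by
  \<open>\<beta> (v + 1) / \<beta> v\<close>, which telescopes to the product of the \<open>\<gamma> i\<close> with \<open>1 \<le> i \<le> v\<close>. These are
  exactly the \<open>i\<close> for which \<open>\<lfloor>n / s ^ i\<rfloor>\<close> increases by one.

  Generalising \<open>\<beta>\<close> to a set \<open>U\<close> of forbidden elements gives a linear system with one unknown sequence
  per \<open>U\<close>. If \<open>E\<close> is finite or cofinite, finitely many \<open>U\<close> suffice, so \<open>\<beta>\<close> is a linear recurrence;
  if \<open>E\<close> is cofinite, then \<open>\<beta> (M + j) = (1 - \<alpha>) ^ j * (b + j * c)\<close> for some \<open>M\<close>, \<open>b\<close> and \<open>c\<close>.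
\<close>

section \<open>Weighted sums over the subsets of a finite set\<close>

text \<open>For finite \<open>X\<close> and \<open>0 \<le> \<alpha> \<le> 1\<close> this is the
  probability that a random subset of \<open>X\<close> satisfies \<open>P\<close>. The carrier type
  is arbitrary so that integers, chains and exponents are treated alike.\<close>

definition bern_sum :: "real \<Rightarrow> 'a set \<Rightarrow> ('a set \<Rightarrow> bool) \<Rightarrow> real" where
  "bern_sum \<alpha> X P = (\<Sum>B\<in>{B\<in>Pow X. P B}. \<alpha> ^ card B * (1 - \<alpha>) ^ card (X - B))"

lemma bern_sum_cong:
  assumes "X = Y" and "\<And>B. B \<subseteq> Y \<Longrightarrow> P B \<longleftrightarrow> Q B"
  shows "bern_sum \<alpha> X P = bern_sum \<alpha> Y Q"
  unfolding bern_sum_def using assms by (intro sum.cong) auto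

lemma bern_sum_empty: "bern_sum \<alpha> {} P = (if P {} then 1 else 0)"
proof -
  have "{B \<in> Pow {}. P B} = (if P {} then {{}} else {})" by auto
  then show ?thesis by (simp add: bern_sum_def)
qed

text \<open>Splits by whether \<open>x\<close> is chosen. Reindexing and independence below follow
  from this recursion by induction, without measure theory.\<close>

lemma bern_sum_insert:
  assumes "finite X" and "x \<notin> X"
  shows "bern_sum \<alpha> (insert x X) P =
    (1 - \<alpha>) * bern_sum \<alpha> X P + \<alpha> * bern_sum \<alpha> X (\<lambda>B. P (insert x B))"
proof -
  let ?w = "\<lambda>B. \<alpha> ^ card B * (1 - \<alpha>) ^ card (insert x X - B)"
  let ?S = "{B \<in> Pow X. P B}" and ?T = "{B \<in> Pow X. P (insert x B)}"
  have fin: "finite ?S" "finite ?T" using assms by auto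
  have inj: "inj_on (insert x) ?T" using assms by (auto intro!: inj_onI dest: insert_ident[THEN iffD1, rotated 2])
  have split: "{B \<in> Pow (insert x X). P B} = ?S \<union> insert x ` ?T"
  proof (intro equalityI subsetI)
    fix B assume B: "B \<in> {B \<in> Pow (insert x X). P B}"
    show "B \<in> ?S \<union> insert x ` ?T"
    proof (cases "x \<in> B")
      case True
      then have "B - {x} \<in> ?T" "B = insert x (B - {x})" using B by (auto simp: insert_absorb)
      then show ?thesis by blast
    qed (use B in auto)
  qed auto
  have "bern_sum \<alpha> (insert x X) P = sum ?w ?S + sum ?w (insert x ` ?T)"
    unfolding bern_sum_def split using fin assms by (intro sum.union_disjoint) auto
  also have "sum ?w ?S = (1 - \<alpha>) * bern_sum \<alpha> X P"
    unfolding bern_sum_def sum_distrib_left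
  proof (rule sum.cong)
    fix B assume "B \<in> ?S"
    then have "insert x X - B = insert x (X - B)" using assms by auto
    then show "?w B = (1 - \<alpha>) * (\<alpha> ^ card B * (1 - \<alpha>) ^ card (X - B))"
      using assms by simp
  qed simp
  also have "sum ?w (insert x ` ?T) = \<alpha> * bern_sum \<alpha> X (\<lambda>B. P (insert x B))"
    unfolding bern_sum_def sum_distrib_left sum.reindex[OF inj] o_def
  proof (rule sum.cong)
    fix B assume "B \<in> ?T"
    then have "insert x X - insert x B = X - B" "x \<notin> B" "finite B"
      using assms finite_subset by auto
    then show "?w (insert x B) = \<alpha> * (\<alpha> ^ card B * (1 - \<alpha>) ^ card (X - B))" by simp
  qed simp
  finally show ?thesis .
qed

lemma bern_sum_image:
  assumes "finite X" and "inj_on f X"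
  shows "bern_sum \<alpha> (f ` X) P = bern_sum \<alpha> X (\<lambda>B. P (f ` B))"
  using assms
proof (induction X arbitrary: P rule: finite_induct)
  case (insert x X)
  then have "f x \<notin> f ` X" "inj_on f X" by auto
  with insert show ?case by (simp add: bern_sum_insert)
qed (simp add: bern_sum_empty)

lemma bern_sum_eq_0: "(\<And>B. B \<subseteq> X \<Longrightarrow> \<not> P B) \<Longrightarrow> bern_sum \<alpha> X P = 0"
  unfolding bern_sum_def by (intro sum.neutral) auto

text \<open>Independence of the traces on two disjoint carriers. \<open>P\<close> varies in the
  induction because, once \<open>x\<close> is chosen, the hypothesis is applied to
  \<open>\<lambda>B. P (insert x B)\<close>.\<close>

lemma bern_sum_Un_disjoint:
  assumes "finite X" and "finite Y" and "X \<inter> Y = {}"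
  shows "bern_sum \<alpha> (X \<union> Y) (\<lambda>B. P (B \<inter> X) \<and> Q (B \<inter> Y)) = bern_sum \<alpha> X P * bern_sum \<alpha> Y Q"
  using assms(1,3)
proof (induction X arbitrary: P rule: finite_induct)
  case empty
  show ?case
  proof (cases "P {}")
    case True
    then show ?thesis by (auto simp: bern_sum_empty Int_absorb2 intro!: bern_sum_cong)
  qed (auto simp: bern_sum_empty intro!: bern_sum_eq_0)
next
  case (insert x X)
  have x: "x \<notin> X \<union> Y" using insert by auto
  have "bern_sum \<alpha> (insert x X \<union> Y) (\<lambda>B. P (B \<inter> insert x X) \<and> Q (B \<inter> Y)) =
     (1 - \<alpha>) * bern_sum \<alpha> (X \<union> Y) (\<lambda>B. P (B \<inter> insert x X) \<and> Q (B \<inter> Y)) +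
     \<alpha> * bern_sum \<alpha> (X \<union> Y) (\<lambda>B. P (insert x B \<inter> insert x X) \<and> Q (insert x B \<inter> Y))"
    using bern_sum_insert[OF _ x, of \<alpha> "\<lambda>B. P (B \<inter> insert x X) \<and> Q (B \<inter> Y)"] insert.hyps assms(2)
    by simp
  also have "bern_sum \<alpha> (X \<union> Y) (\<lambda>B. P (B \<inter> insert x X) \<and> Q (B \<inter> Y)) = bern_sum \<alpha> X P * bern_sum \<alpha> Y Q"
  proof (subst insert.IH[symmetric])
    show "X \<inter> Y = {}" using insert by auto
    have "B \<inter> insert x X = B \<inter> X" if "B \<subseteq> X \<union> Y" for B using that x by auto
    then show "bern_sum \<alpha> (X \<union> Y) (\<lambda>B. P (B \<inter> insert x X) \<and> Q (B \<inter> Y)) =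
       bern_sum \<alpha> (X \<union> Y) (\<lambda>B. P (B \<inter> X) \<and> Q (B \<inter> Y))"
      by (intro bern_sum_cong) auto
  qed
  also have "bern_sum \<alpha> (X \<union> Y) (\<lambda>B. P (insert x B \<inter> insert x X) \<and> Q (insert x B \<inter> Y)) =
     bern_sum \<alpha> X (\<lambda>B. P (insert x B)) * bern_sum \<alpha> Y Q"
  proof (subst insert.IH[symmetric])
    show "X \<inter> Y = {}" using insert by auto
    have "insert x B \<inter> insert x X = insert x (B \<inter> X)" "insert x B \<inter> Y = B \<inter> Y" for B using x by auto
    then show "bern_sum \<alpha> (X \<union> Y) (\<lambda>B. P (insert x B \<inter> insert x X) \<and> Q (insert x B \<inter> Y)) =
       bern_sum \<alpha> (X \<union> Y) (\<lambda>B. P (insert x (B \<inter> X)) \<and> Q (B \<inter> Y))"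
      by simp
  qed
  finally show ?case using insert by (simp add: bern_sum_insert algebra_simps)
qed

text \<open>The empty subset alone contributes a positive term. This is why \<open>gamma_seq\<close>
  never divides by zero later.\<close>

lemma bern_sum_pos:
  assumes "finite X" and "0 < \<alpha>" and "\<alpha> < 1" and "P {}"
  shows "0 < bern_sum \<alpha> X P"
  unfolding bern_sum_def
proof (rule sum_pos2)
  show "0 < \<alpha> ^ card {} * (1 - \<alpha>) ^ card (X - {})" using assms by simp
qed (use assms in auto)

section \<open>The law of the random subset\<close>

lemma pmf_random_subset:
  assumes "0 \<le> \<alpha>" and "\<alpha> \<le> 1" and "B \<subseteq> {1..n}"
  shows "pmf (random_subset_pmf n \<alpha>) B = \<alpha> ^ card B * (1 - \<alpha>) ^ card ({1..n} - B)"
proof -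
  let ?F = "\<lambda>f. {x \<in> {1..n}. f x}"
  let ?p = "Pi_pmf {1..n} False (\<lambda>_. bernoulli_pmf \<alpha>)"
  have supp: "f x = False" if "f \<in> set_pmf ?p" "x \<notin> {1..n}" for f x
    using that set_Pi_pmf_subset[of "{1..n}" False "\<lambda>_. bernoulli_pmf \<alpha>"] by auto
  \<comment> \<open>Functions in the support take the default value \<open>False\<close> outside
    \<open>{1..n}\<close>, so only the indicator of \<open>B\<close> is mapped to
    \<open>B\<close>.\<close>
  have eq: "f = (\<lambda>x. x \<in> B) \<longleftrightarrow> ?F f = B" if "f \<in> set_pmf ?p" for f
    using supp[OF that] assms(3) by (auto simp: fun_eq_iff)
  have "pmf (random_subset_pmf n \<alpha>) B = measure_pmf.prob ?p (?F -` {B})"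
    unfolding random_subset_pmf_def by (rule pmf_map)
  also have "\<dots> = measure_pmf.prob ?p {\<lambda>x. x \<in> B}"
    by (intro measure_pmf.finite_measure_eq_AE) (auto simp: AE_measure_pmf_iff eq)
  also have "\<dots> = pmf ?p (\<lambda>x. x \<in> B)" by (simp add: measure_pmf_single)
  also have "\<dots> = (\<Prod>x\<in>{1..n}. pmf (bernoulli_pmf \<alpha>) (x \<in> B))"
    using assms(3) by (subst pmf_Pi') auto
  also have "\<dots> = (\<Prod>x\<in>B. pmf (bernoulli_pmf \<alpha>) (x \<in> B)) * (\<Prod>x\<in>{1..n} - B. pmf (bernoulli_pmf \<alpha>) (x \<in> B))"
    using assms(3) by (subst prod.subset_diff[of B]) (auto simp: mult.commute)
  also have "\<dots> = \<alpha> ^ card B * (1 - \<alpha>) ^ card ({1..n} - B)"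
    using assms(1,2) by simp
  finally show ?thesis .
qed

lemma prob_random_subset:
  assumes "0 \<le> \<alpha>" and "\<alpha> \<le> 1"
  shows "measure_pmf.prob (random_subset_pmf n \<alpha>) {A. P A} = bern_sum \<alpha> {1..n} P"
proof -
  let ?p = "random_subset_pmf n \<alpha>"
  have "set_pmf ?p \<subseteq> Pow {1..n}" unfolding random_subset_pmf_def by auto
  then have "measure_pmf.prob ?p {A. P A} = measure_pmf.prob ?p {A \<in> Pow {1..n}. P A}"
    by (intro measure_pmf.finite_measure_eq_AE) (auto simp: AE_measure_pmf_iff)
  also have "\<dots> = (\<Sum>A\<in>{A \<in> Pow {1..n}. P A}. pmf ?p A)"
    by (intro measure_measure_pmf_finite) auto
  also have "\<dots> = bern_sum \<alpha> {1..n} P"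
    unfolding bern_sum_def using assms by (intro sum.cong) (auto simp: pmf_random_subset)
  finally show ?thesis .
qed

section \<open>Gap-free sets of exponents and their weights\<close>

definition gap_free :: "nat set \<Rightarrow> nat set \<Rightarrow> bool" where
  "gap_free E B \<longleftrightarrow> (\<forall>e\<in>E. \<forall>b\<in>B. b + e \<notin> B)"

lemma gap_free_Suc_image: "gap_free E (Suc ` B) \<longleftrightarrow> gap_free E B"
  by (auto simp: gap_free_def)

text \<open>The carrier starts at \<open>0\<close>, so dropping its least element and shifting down
  replaces \<open>U\<close> by its preimage under \<open>Suc\<close>. Translation invariance makes
  \<open>U = {}\<close> agree with the sequence on \<open>{1..j}\<close>.\<close>

definition gap_weight :: "nat set \<Rightarrow> real \<Rightarrow> nat set \<Rightarrow> nat \<Rightarrow> real" where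
  "gap_weight E \<alpha> U j = bern_sum \<alpha> {..<j} (\<lambda>B. gap_free E B \<and> B \<inter> U = {})"

lemma gap_weight_0: "gap_weight E \<alpha> U 0 = 1"
  by (simp add: gap_weight_def bern_sum_empty gap_free_def)

text \<open>Conditioning on whether \<open>0\<close> is chosen: if it is, then the elements of \<open>E\<close> become forbidden.\<close>

lemma gap_weight_Suc:
  assumes "0 \<notin> E"
  shows "gap_weight E \<alpha> U (Suc j) = (1 - \<alpha>) * gap_weight E \<alpha> (Suc -` U) j +
    (if 0 \<in> U then 0 else \<alpha> * gap_weight E \<alpha> (Suc -` (U \<union> E)) j)"
proof -
  let ?P = "\<lambda>B. gap_free E B \<and> B \<inter> U = {}"
  have free: "gap_free E (insert 0 (Suc ` B)) \<longleftrightarrow> gap_free E B \<and> B \<inter> Suc -` E = {}" for B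
    using assms by (auto simp: gap_free_def)
  have "gap_weight E \<alpha> U (Suc j) =
    (1 - \<alpha>) * bern_sum \<alpha> {..<j} (\<lambda>B. ?P (Suc ` B)) + \<alpha> * bern_sum \<alpha> {..<j} (\<lambda>B. ?P (insert 0 (Suc ` B)))"
    unfolding gap_weight_def lessThan_Suc_eq_insert_0
    by (subst bern_sum_insert) (auto simp: bern_sum_image)
  also have "bern_sum \<alpha> {..<j} (\<lambda>B. ?P (Suc ` B)) = gap_weight E \<alpha> (Suc -` U) j"
    unfolding gap_weight_def by (rule bern_sum_cong) (auto simp: gap_free_Suc_image)
  also have "bern_sum \<alpha> {..<j} (\<lambda>B. ?P (insert 0 (Suc ` B))) =
    (if 0 \<in> U then 0 else gap_weight E \<alpha> (Suc -` (U \<union> E)) j)"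
    unfolding gap_weight_def free by (auto intro!: bern_sum_cong bern_sum_eq_0)
  finally show ?thesis by simp
qed

lemma gap_weight_pos: "0 < \<alpha> \<Longrightarrow> \<alpha> < 1 \<Longrightarrow> 0 < gap_weight E \<alpha> U j"
  unfolding gap_weight_def by (rule bern_sum_pos) (auto simp: gap_free_def)

section \<open>From a finite linear system to a linear recurrence\<close>

text \<open>Gaussian elimination, one coordinate per induction step: a pivot \<open>p\<close> clears
  coordinate \<open>s\<close> from the other vectors. Indexing by \<open>I\<close> lets repeated
  vectors count as dependent.\<close>

lemma ex_linear_dependence:
  fixes v :: "'i \<Rightarrow> 's \<Rightarrow> real"
  assumes "finite S" and "finite I" and "card S < card I"
  shows "\<exists>a. (\<exists>i\<in>I. a i \<noteq> 0) \<and> (\<forall>s\<in>S. (\<Sum>i\<in>I. a i * v i s) = 0)"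
  using assms
proof (induction S arbitrary: I v rule: finite_induct)
  case empty
  then have "I \<noteq> {}" by auto
  then show ?case by (intro exI[of _ "\<lambda>_. 1"]) auto
next
  case (insert s S)
  show ?case
  proof (cases "\<forall>i\<in>I. v i s = 0")
    case True
    have "card S < card I" using insert by simp
    from insert.IH[OF insert.prems(1) this, of v] True show ?thesis by auto
  next
    case False
    then obtain p where p: "p \<in> I" "v p s \<noteq> 0" by auto
    define w where "w i t = v i t - v i s / v p s * v p t" for i t
    have "card S < card (I - {p})" using insert p by simp
    from insert.IH[OF _ this, of w] insert.prems obtain a
      where a: "\<exists>i\<in>I - {p}. a i \<noteq> 0" "\<forall>t\<in>S. (\<Sum>i\<in>I - {p}. a i * w i t) = 0" by auto
    \<comment> \<open>The coefficient at \<open>p\<close> collects the multiples of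
      \<open>v p\<close> that were subtracted in \<open>w\<close>.\<close>
    define b where "b = a(p := - (\<Sum>i\<in>I - {p}. a i * v i s) / v p s)"
    have b: "(\<Sum>i\<in>I. b i * v i t) = (\<Sum>i\<in>I - {p}. a i * w i t)" for t
    proof -
      have "(\<Sum>i\<in>I. b i * v i t) = b p * v p t + (\<Sum>i\<in>I - {p}. b i * v i t)"
        using insert.prems p by (simp add: sum.remove)
      also have "(\<Sum>i\<in>I - {p}. b i * v i t) = (\<Sum>i\<in>I - {p}. a i * v i t)"
        by (intro sum.cong) (auto simp: b_def)
      also have "b p * v p t = (\<Sum>i\<in>I - {p}. - (a i * (v i s / v p s * v p t)))"
        by (simp add: b_def sum_distrib_right sum_divide_distrib sum_negf mult.assoc)
      also have "\<dots> + (\<Sum>i\<in>I - {p}. a i * v i t) = (\<Sum>i\<in>I - {p}. a i * w i t)"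
        by (simp add: w_def sum.distrib[symmetric] algebra_simps)
      finally show ?thesis .
    qed
    have "w i s = 0" for i using p by (simp add: w_def)
    then have "\<forall>t\<in>insert s S. (\<Sum>i\<in>I. b i * v i t) = 0" using a b by auto
    moreover have "\<exists>i\<in>I. b i \<noteq> 0" using a by (auto simp: b_def)
    ultimately show ?thesis by blast
  qed
qed

text \<open>The first \<open>card S + 1\<close> shifts of \<open>G s\<close> are combinations of the \<open>card S\<close> sequences
  \<open>G t\<close>, hence linearly dependent.\<close>

lemma linear_recurrence_finite_system:
  fixes G :: "'s \<Rightarrow> nat \<Rightarrow> real"
  assumes "finite S" and "s \<in> S"
    and step: "\<And>s j. s \<in> S \<Longrightarrow> G s (Suc j) = (\<Sum>t\<in>S. T s t * G t j)"
  shows "linear_recurrence (G s)"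
proof -
  \<comment> \<open>The coefficients do not depend on \<open>j\<close>, so one dependence among them
    yields a relation valid for all \<open>j\<close>.\<close>
  have "\<exists>c. \<forall>j. G s (j + i) = (\<Sum>t\<in>S. c t * G t j)" for i
  proof (induction i)
    case 0
    have "G s j = (\<Sum>t\<in>S. of_bool (t = s) * G t j)" for j
      proof -
      have "(\<Sum>t\<in>S. of_bool (t = s) * G t j) = (\<Sum>t\<in>S. if t = s then G t j else 0)"
        by (intro sum.cong) auto
      then show ?thesis using assms(1,2) by simp
    qed
    then show ?case by (intro exI[of _ "\<lambda>t. of_bool (t = s)"]) simp
  next
    case (Suc i)
    then obtain c where c: "\<And>j. G s (j + i) = (\<Sum>t\<in>S. c t * G t j)" by blast
    have "G s (j + Suc i) = (\<Sum>u\<in>S. (\<Sum>t\<in>S. c t * T t u) * G u j)" for j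
    proof -
      have "G s (j + Suc i) = (\<Sum>t\<in>S. c t * G t (Suc j))" using c[of "Suc j"] by simp
      also have "\<dots> = (\<Sum>t\<in>S. \<Sum>u\<in>S. c t * T t u * G u j)"
        by (simp add: step sum_distrib_left mult.assoc)
      also have "\<dots> = (\<Sum>u\<in>S. \<Sum>t\<in>S. c t * T t u * G u j)" by (rule sum.swap)
      finally show ?thesis by (simp add: sum_distrib_right)
    qed
    then show ?case by (intro exI[of _ "\<lambda>u. \<Sum>t\<in>S. c t * T t u"]) simp
  qed
  then obtain c where c: "\<And>i j. G s (j + i) = (\<Sum>t\<in>S. c i t * G t j)" by metis
  obtain a where a: "\<exists>i\<in>{..card S}. a i \<noteq> 0" "\<And>t. t \<in> S \<Longrightarrow> (\<Sum>i\<le>card S. a i * c i t) = 0"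
    using ex_linear_dependence[OF assms(1), of "{..card S}" c] by auto
  have rel: "(\<Sum>i\<le>card S. a i * G s (j + i)) = 0" for j
  proof -
    have "(\<Sum>i\<le>card S. a i * G s (j + i)) = (\<Sum>i\<le>card S. \<Sum>t\<in>S. a i * c i t * G t j)"
      by (simp add: c sum_distrib_left mult.assoc)
    also have "\<dots> = (\<Sum>t\<in>S. (\<Sum>i\<le>card S. a i * c i t) * G t j)"
      by (subst sum.swap) (simp add: sum_distrib_right)
    finally show ?thesis using a by simp
  qed
  \<comment> \<open>The relation is solved for its last term with nonzero coefficient.\<close>
  define k where "k = Max {i. i \<le> card S \<and> a i \<noteq> 0}"
  have fin: "finite {i. i \<le> card S \<and> a i \<noteq> 0}" by simp
  have k: "k \<le> card S" "a k \<noteq> 0"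
  proof -
    have "{i. i \<le> card S \<and> a i \<noteq> 0} \<noteq> {}" using a(1) by auto
    from Max_in[OF fin this] have "k \<in> {i. i \<le> card S \<and> a i \<noteq> 0}" unfolding k_def .
    then show "k \<le> card S" "a k \<noteq> 0" by auto
  qed
  have above: "a i = 0" if "k < i" "i \<le> card S" for i
    using Max_ge[OF fin, of i] that unfolding k_def by fastforce
  have rel_k: "(\<Sum>i<k. a i * G s (j + i)) + a k * G s (j + k) = 0" for j
  proof -
    have "(\<Sum>i\<le>k. a i * G s (j + i)) = (\<Sum>i\<le>card S. a i * G s (j + i))"
      using k above by (intro sum.mono_neutral_left) auto
    then show ?thesis using rel by (simp add: lessThan_Suc_atMost[symmetric])
  qed
  \<comment> \<open>The order is \<open>Suc k\<close> with vanishing last constant because \<open>k = 0\<close> is possible a priori.\<close>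
  have "G s j = (\<Sum>i=1..Suc k. (if i \<le> k then - a (k - i) / a k else 0) * G s (j - i))" if "Suc k \<le> j" for j
  proof -
    have "(\<Sum>i=1..Suc k. (if i \<le> k then - a (k - i) / a k else 0) * G s (j - i))
        = (\<Sum>i=1..k. - a (k - i) / a k * G s (j - i))"
    proof -
      have "{1..Suc k} = insert (Suc k) {1..k}" by auto
      then show ?thesis by (auto intro!: sum.cong)
    qed
    also have "\<dots> = (\<Sum>i<k. - a i / a k * G s (j - k + i))"
      using that by (intro sum.reindex_bij_witness[of _ "\<lambda>i. k - i" "\<lambda>i. k - i"]) auto
    also have "\<dots> = - (\<Sum>i<k. a i * G s (j - k + i)) / a k"
      by (simp add: sum_negf sum_divide_distrib)
    also have "\<dots> = G s j"
      using rel_k[of "j - k"] k that by (simp add: field_simps)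
    finally show ?thesis by simp
  qed
  then show ?thesis unfolding linear_recurrence_def by (intro exI[of _ "Suc k"] exI[of _ "\<lambda>i. if i \<le> k then - a (k - i) / a k else 0"] conjI allI impI) simp_all
qed

lemma linear_recurrence_gap_weight:
  assumes "0 \<notin> E" and M: "E \<subseteq> {..M} \<or> {M<..} \<subseteq> E"
  shows "linear_recurrence (gap_weight E \<alpha> {})"
proof -
  \<comment> \<open>A member of \<open>S\<close> is determined by its trace below \<open>M\<close>
    and by whether it contains all or nothing from \<open>M\<close> on, so \<open>S\<close> is
    finite. It is closed under both shifts in \<open>gap_weight_Suc\<close>, because the preimage of
    \<open>E\<close> under \<open>Suc\<close> lies in \<open>S\<close>.\<close>
  define S where "S = {U. U \<subseteq> {..<M} \<or> {M..} \<subseteq> U}"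
  have "S \<subseteq> Pow {..<M} \<union> uminus ` Pow {..<M}"
  proof
    fix U assume "U \<in> S"
    then consider "U \<subseteq> {..<M}" | "{M..} \<subseteq> U" unfolding S_def by fast
    then show "U \<in> Pow {..<M} \<union> uminus ` Pow {..<M}"
    proof cases
      case 2
      then have "- U \<subseteq> {..<M}" using Compl_anti_mono[OF 2] by (simp only: Compl_atLeast)
      then have "- (- U) \<in> uminus ` Pow {..<M}" by (intro imageI PowI)
      then show ?thesis by (simp only: double_complement UnI2)
    qed simp
  qed
  then have fin: "finite S" by (rule finite_subset) simp
  have shift: "Suc -` U \<in> S" "Suc -` (U \<union> E) \<in> S" if U: "U \<in> S" for U
  proof -
    show "Suc -` U \<in> S" using U unfolding S_def by fastforce
    consider "U \<subseteq> {..<M}" "E \<subseteq> {..M}" | "{M..} \<subseteq> U" | "{M<..} \<subseteq> E"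
      using U M unfolding S_def by blast
    then show "Suc -` (U \<union> E) \<in> S"
    proof cases
      case 1
      then have "Suc -` (U \<union> E) \<subseteq> {..<M}" by fastforce
      then show ?thesis by (simp add: S_def)
    next
      case 2
      have "{M..} \<subseteq> Suc -` (U \<union> E)" by (auto intro!: subsetD[OF 2])
      then show ?thesis by (simp add: S_def)
    next
      case 3
      have "{M..} \<subseteq> Suc -` (U \<union> E)" by (auto intro!: subsetD[OF 3])
      then show ?thesis by (simp add: S_def)
    qed
  qed
  show ?thesis
  proof (rule linear_recurrence_finite_system[OF fin])
    show "{} \<in> S" by (simp add: S_def)
    fix U j assume U: "U \<in> S"
    have pick: "(\<Sum>V\<in>S. x * of_bool (V = W) * gap_weight E \<alpha> V j) = x * gap_weight E \<alpha> W j"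
      if "W \<in> S" for x W
    proof -
      have "(\<Sum>V\<in>S. x * of_bool (V = W) * gap_weight E \<alpha> V j) =
        (\<Sum>V\<in>S. if V = W then x * gap_weight E \<alpha> V j else 0)" by (intro sum.cong) auto
      then show ?thesis using fin that by simp
    qed
    \<comment> \<open>Adding two indicator coefficients also covers the case where the two shifted
      sets coincide.\<close>
    show "gap_weight E \<alpha> U (Suc j) = (\<Sum>V\<in>S. ((1 - \<alpha>) * of_bool (V = Suc -` U) +
      (if 0 \<in> U then 0 else \<alpha>) * of_bool (V = Suc -` (U \<union> E))) * gap_weight E \<alpha> V j)"
      by (simp only: gap_weight_Suc[OF assms(1)] distrib_right sum.distrib pick shift[OF U]) simp
  qed
qed

section \<open>Cofinite \<open>E\<close>: closed form and rationality\<close>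

text \<open>Each position from \<open>M\<close> on is forbidden and contributes only a factor
  \<open>1 - \<alpha>\<close>. Both shifted sets in the recursion contain everything from one
  position earlier, whence the induction on \<open>M\<close> with \<open>U\<close>
  arbitrary.\<close>

lemma gap_weight_cofinite:
  assumes "0 \<notin> E" and "{M..} \<subseteq> U"
  shows "gap_weight E \<alpha> U (M + j) = (1 - \<alpha>) ^ j * gap_weight E \<alpha> U M"
  using assms(2)
proof (induction M arbitrary: U)
  case 0
  have "gap_weight E \<alpha> UNIV j = (1 - \<alpha>) ^ j"
    by (induction j) (auto simp: gap_weight_0 gap_weight_Suc[OF assms(1)])
  moreover have "U = UNIV" using 0 by auto
  ultimately show ?case by (simp add: gap_weight_0)
next
  case (Suc M)
  have "{M..} \<subseteq> Suc -` U" "{M..} \<subseteq> Suc -` (U \<union> E)" using Suc.prems by auto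
  from this[THEN Suc.IH] show ?case
    by (simp add: gap_weight_Suc[OF assms(1)] algebra_simps)
qed

text \<open>If \<open>0\<close> is chosen, almost everything is forbidden and the remaining weight
  decays geometrically; otherwise the sequence repeats itself. The geometric forcing has the same
  ratio \<open>1 - \<alpha>\<close> as the recursion, which produces the linear factor.\<close>

lemma gap_weight_cofinite_gaps:
  assumes "0 < \<alpha>" and "\<alpha> < 1" and "0 \<notin> E" and "{M<..} \<subseteq> E"
  obtains b c where "0 < b" "0 < c" "\<And>j. gap_weight E \<alpha> {} (M + j) = (1 - \<alpha>) ^ j * (b + real j * c)"
proof -
  \<comment> \<open>Dividing by \<open>1 - \<alpha>\<close> turns the forcing term into
    \<open>(1 - \<alpha>) ^ Suc j * c\<close>.\<close>
  define c where "c = \<alpha> * gap_weight E \<alpha> (Suc -` E) M / (1 - \<alpha>)"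
  have sub: "{M..} \<subseteq> Suc -` E" using assms(4) by (auto intro!: subsetD[OF assms(4)])
  have "gap_weight E \<alpha> {} (M + j) = (1 - \<alpha>) ^ j * (gap_weight E \<alpha> {} M + real j * c)" for j
  proof (induction j)
    case (Suc j)
    have "gap_weight E \<alpha> {} (M + Suc j) =
      (1 - \<alpha>) * gap_weight E \<alpha> {} (M + j) + \<alpha> * gap_weight E \<alpha> (Suc -` E) (M + j)"
      by (simp add: gap_weight_Suc[OF assms(3)])
    also have "\<alpha> * gap_weight E \<alpha> (Suc -` E) (M + j) = (1 - \<alpha>) ^ Suc j * c"
      using assms(2) by (simp add: gap_weight_cofinite[OF assms(3) sub] c_def)
    finally show ?case by (simp add: Suc algebra_simps)
  qed simp
  moreover have "0 < gap_weight E \<alpha> {} M" "0 < c"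
    unfolding c_def using assms(1,2) by (auto intro!: gap_weight_pos divide_pos_pos mult_pos_pos)
  ultimately show ?thesis using that by blast
qed

text \<open>The powers of the real \<open>q\<close> cancel, since the exponents of the outer terms
  sum to twice the middle one. Only linear factors remain.\<close>

lemma gamma_seq_rational:
  assumes "0 < q" and "0 < b" and "0 < c"
    and \<beta>: "\<And>j. \<beta> (M + j) = q ^ j * (b + real j * c)"
  shows "\<exists>p q :: real poly. q \<noteq> 0 \<and>
    (\<forall>\<^sub>F i in sequentially. gamma_seq \<beta> i = poly p (real i) / poly q (real i))"
proof -
  \<comment> \<open>Rewrites the linear factor in terms of the index itself: for
    \<open>i = M + j\<close>, \<open>b + real j * c = a + real i * c\<close>.\<close>
  define a where "a = b - real M * c"
  have "gamma_seq \<beta> i = poly ([:a - c, c:] * [:a + c, c:]) (real i) / poly ([:a, c:]\<^sup>2) (real i)" if "Suc M \<le> i" for i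
  proof -
    define j where "j = i - Suc M"
    have i: "i - 1 = M + j" "i = M + Suc j" "i + 1 = M + Suc (Suc j)" using that by (auto simp: j_def)
    have "gamma_seq \<beta> i = (q ^ j * (b + real j * c)) * (q ^ Suc (Suc j) * (b + real (Suc (Suc j)) * c)) /
       (q ^ Suc j * (b + real (Suc j) * c))\<^sup>2"
      unfolding gamma_seq_def i(1,3) \<beta> unfolding i(2) \<beta> ..
    also have "\<dots> = (q ^ Suc j)\<^sup>2 * ((b + real j * c) * (b + real (Suc (Suc j)) * c)) /
       ((q ^ Suc j)\<^sup>2 * (b + real (Suc j) * c)\<^sup>2)"
      by (simp add: power2_eq_square mult_ac)
    also have "\<dots> = (b + real j * c) * (b + real (Suc (Suc j)) * c) / (b + real (Suc j) * c)\<^sup>2"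
      using assms(1) by (intro mult_divide_mult_cancel_left) auto
    also have "\<dots> = poly ([:a - c, c:] * [:a + c, c:]) (real i) / poly ([:a, c:]\<^sup>2) (real i)"
      by (simp add: a_def i(2) algebra_simps power2_eq_square)
    finally show ?thesis .
  qed
  then show ?thesis using assms(3)
    by (intro exI[of _ "[:a - c, c:] * [:a + c, c:]"] exI[of _ "[:a, c:]\<^sup>2"] conjI eventually_sequentiallyI[of "Suc M"]) auto
qed

section \<open>Telescoping, and translation to \<open>{1..j}\<close>\<close>

text \<open>\<open>gamma_seq \<beta> i\<close> is the quotient of the consecutive ratios
  \<open>\<beta> (i + 1) / \<beta> i\<close> and \<open>\<beta> i / \<beta> (i - 1)\<close>; the
  lowest ratio \<open>\<beta> 1 / \<beta> 0\<close> is \<open>1\<close>.\<close>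

lemma prod_gamma_seq:
  assumes "\<And>i. \<beta> i \<noteq> 0" and "\<beta> 0 = \<beta> 1"
  shows "(\<Prod>i=1..v. gamma_seq \<beta> i) = \<beta> (Suc v) / \<beta> v"
proof (induction v)
  case (Suc v)
  then show ?case using assms(1)[of "Suc v"] assms(1)[of v] by (simp add: gamma_seq_def power2_eq_square)
qed (use assms(1)[of 1] assms(2) in simp)


lemma bern_sum_gap_free_atLeastAtMost:
  "bern_sum \<alpha> {1..j} (gap_free E) = gap_weight E \<alpha> {} j"
proof -
  have "{1..j} = Suc ` {..<j}" by (simp add: image_Suc_lessThan)
  then show ?thesis by (simp add: bern_sum_image gap_weight_def gap_free_Suc_image)
qed

section \<open>Geometric chains with ratio \<open>r / s\<close>\<close>

text \<open>Cross-multiplied, so that the combinatorics stays in the natural numbers.\<close>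

definition ratio_free :: "nat set \<Rightarrow> nat \<Rightarrow> nat \<Rightarrow> nat set \<Rightarrow> bool" where
  "ratio_free E r s A \<longleftrightarrow> (\<forall>e\<in>E. \<forall>a\<in>A. \<forall>b\<in>A. a * s ^ e \<noteq> b * r ^ e)"

lemma ratio_free_iff:
  assumes "0 < s" and "0 \<notin> A"
  shows "ratio_free E r s A \<longleftrightarrow> \<not> (\<exists>e\<in>E. (of_nat r / of_nat s :: rat) ^ e \<in> ratio_set A)"
proof -
  have "a * s ^ e = b * r ^ e \<longleftrightarrow> (of_nat r / of_nat s :: rat) ^ e = of_nat a / of_nat b"
    if "b \<in> A" for a b e
  proof -
    have "b \<noteq> 0" using that assms by metis
    then have "(of_nat r / of_nat s :: rat) ^ e = of_nat a / of_nat b \<longleftrightarrow>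
      (of_nat (a * s ^ e) :: rat) = of_nat (b * r ^ e)"
      using assms(1) by (auto simp: power_divide divide_simps mult.commute)
    then show ?thesis by (simp only: of_nat_eq_iff)
  qed
  then show ?thesis by (force simp: ratio_free_def ratio_set_def)
qed

text \<open>Injectivity of \<open>k\<close> to \<open>(r / s) ^ k\<close>, without division. If
  \<open>i < j\<close>, cancelling \<open>(r * s) ^ i\<close> leaves equal positive powers of
  \<open>r\<close> and \<open>s\<close>, against \<open>r < s\<close>.\<close>

lemma ratio_powers_eq_iff:
  fixes r s :: nat
  assumes "0 < r" and "r < s"
  shows "r ^ i * s ^ j = r ^ j * s ^ i \<longleftrightarrow> i = j"
proof
  have *: "\<not> i < j" if "r ^ i * s ^ j = r ^ j * s ^ i" for i j
  proof
    assume "i < j"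
    then obtain d where d: "j = i + Suc d" using less_iff_Suc_add by auto
    have "(r * s) ^ i * s ^ Suc d = (r * s) ^ i * r ^ Suc d"
      using that by (simp add: d power_add power_mult_distrib mult_ac)
    then have "s ^ Suc d = r ^ Suc d" using assms by simp
    moreover have "r ^ Suc d < s ^ Suc d" using assms by (intro power_strict_mono) auto
    ultimately show False by simp
  qed
  show "r ^ i * s ^ j = r ^ j * s ^ i \<Longrightarrow> i = j"
    using *[of i j] *[of j i] by fastforce
qed simp

text \<open>The integers among \<open>n * (r / s) ^ k\<close>. Descending from \<open>n\<close>
  suffices, as \<open>n\<close> is the largest element of \<open>{1..n}\<close>.\<close>

definition ratio_chain :: "nat \<Rightarrow> nat \<Rightarrow> nat \<Rightarrow> nat set" where
  "ratio_chain r s n = {x. \<exists>k. x * s ^ k = n * r ^ k}"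

text \<open>No forbidden pair links the chain to its complement. From \<open>b\<close> to
  \<open>a\<close> exponents add; from \<open>a\<close> to \<open>b\<close> they subtract, and a
  negative result would force \<open>b > n\<close>.\<close>

lemma ratio_chain_closed:
  assumes "0 < r" and "r < s" and ab: "a * s ^ e = b * r ^ e" and "0 < b" and "b \<le> n"
  shows "a \<in> ratio_chain r s n \<longleftrightarrow> b \<in> ratio_chain r s n"
proof
  assume "b \<in> ratio_chain r s n"
  then obtain k where k: "b * s ^ k = n * r ^ k" by (auto simp: ratio_chain_def)
  have "a * s ^ (e + k) = (a * s ^ e) * s ^ k" by (simp add: power_add mult_ac)
  also have "\<dots> = (b * s ^ k) * r ^ e" by (simp add: ab mult_ac)
  also have "\<dots> = n * r ^ (e + k)" by (simp add: k power_add mult_ac)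
  finally show "a \<in> ratio_chain r s n" by (auto simp: ratio_chain_def)
next
  assume "a \<in> ratio_chain r s n"
  then obtain k where k: "a * s ^ k = n * r ^ k" by (auto simp: ratio_chain_def)
  have "(b * s ^ k) * r ^ e = (a * s ^ k) * s ^ e" by (simp add: ab[symmetric] mult_ac)
  then have eq: "b * s ^ k * r ^ e = n * r ^ k * s ^ e" by (simp add: k)
  show "b \<in> ratio_chain r s n"
  proof (cases "e \<le> k")
    case True
    then obtain d where d: "k = e + d" using le_Suc_ex by blast
    have "(r * s) ^ e * (b * s ^ d) = (r * s) ^ e * (n * r ^ d)"
      using eq by (simp add: d power_add power_mult_distrib mult_ac)
    then have "b * s ^ d = n * r ^ d" using assms(1,2) by simp
    then show ?thesis by (auto simp: ratio_chain_def)
  next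
    case False
    then have "e = k + Suc (e - Suc k)" by simp
    then obtain d where d: "e = k + Suc d" ..
    have "(r * s) ^ k * (b * r ^ Suc d) = (r * s) ^ k * (n * s ^ Suc d)"
      using eq by (simp add: d power_add power_mult_distrib mult_ac)
    then have "b * r ^ Suc d = n * s ^ Suc d" using assms(1,2) by simp
    moreover have "b * r ^ Suc d \<le> n * r ^ Suc d" using assms(5) by simp
    moreover have "n * r ^ Suc d < n * s ^ Suc d"
      using assms(1,2,4,5) by (intro mult_strict_left_mono power_strict_mono) auto
    ultimately show ?thesis by simp
  qed
qed

lemma ratio_free_split:
  assumes "0 < r" and "r < s" and "A \<subseteq> {1..n}"
  shows "ratio_free E r s A \<longleftrightarrow> ratio_free E r s (A \<inter> ratio_chain r s n) \<and> ratio_free E r s (A - ratio_chain r s n)"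
proof -
  have "a \<in> ratio_chain r s n \<longleftrightarrow> b \<in> ratio_chain r s n"
    if "a * s ^ e = b * r ^ e" "b \<in> A" for a b e
    using that assms(3) by (intro ratio_chain_closed[OF assms(1,2)]) auto
  then show ?thesis unfolding ratio_free_def by blast
qed

text \<open>By coprimality, \<open>n * (r / s) ^ k\<close> is an integer exactly when
  \<open>s ^ k\<close> divides \<open>n\<close>, which bounds the exponents by the
  multiplicity.\<close>

lemma ratio_chain_conv_image:
  assumes "0 < r" and "r < s" and "coprime r s" and "0 < n"
  obtains g where "ratio_chain r s n = g ` {..multiplicity s n}" "inj_on g {..multiplicity s n}" "g 0 = n"
    "\<And>k. k \<le> multiplicity s n \<Longrightarrow> g k * s ^ k = n * r ^ k"
proof -
  define g where "g k = n * r ^ k div s ^ k" for k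
  have s: "\<not> is_unit s" "0 < s" using assms(1,2) by auto
  have dvd: "s ^ k dvd n \<longleftrightarrow> k \<le> multiplicity s n" for k
    using assms(4) s by (intro power_dvd_iff_le_multiplicity) auto
  have g: "g k * s ^ k = n * r ^ k" if "k \<le> multiplicity s n" for k
    using that dvd[of k] unfolding g_def by (intro dvd_div_mult_self) auto
  have g': "x * s ^ k = n * r ^ k \<Longrightarrow> k \<le> multiplicity s n \<and> x = g k" for x k
  proof
    assume x: "x * s ^ k = n * r ^ k"
    then have "s ^ k dvd n * r ^ k" by (metis dvd_triv_right)
    moreover have "coprime (s ^ k) (r ^ k)" using assms(3) by (simp add: coprime_commute)
    ultimately show "k \<le> multiplicity s n" using coprime_dvd_mult_left_iff dvd by blast
    show "x = g k" using s x[symmetric] by (simp add: g_def)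
  qed
  show ?thesis
  proof (rule that)
    show "ratio_chain r s n = g ` {..multiplicity s n}"
    proof (intro equalityI subsetI)
      fix x assume "x \<in> ratio_chain r s n"
      then obtain k where "x * s ^ k = n * r ^ k" by (auto simp: ratio_chain_def)
      from g'[OF this] show "x \<in> g ` {..multiplicity s n}" by simp
    next
      fix x assume "x \<in> g ` {..multiplicity s n}"
      then obtain k where "k \<le> multiplicity s n" "x = g k" by auto
      then show "x \<in> ratio_chain r s n" using g by (auto simp: ratio_chain_def)
    qed
    show "inj_on g {..multiplicity s n}"
    proof (rule inj_onI)
      fix i j assume ij: "i \<in> {..multiplicity s n}" "j \<in> {..multiplicity s n}" "g i = g j"
      have "n * (r ^ i * s ^ j) = (g i * s ^ i) * s ^ j" using g[of i] ij by simp
      also have "\<dots> = (g j * s ^ j) * s ^ i" using ij by simp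
      also have "\<dots> = n * (r ^ j * s ^ i)" using g[of j] ij by simp
      finally have "r ^ i * s ^ j = r ^ j * s ^ i" using assms(4) by simp
      then show "i = j" by (simp add: ratio_powers_eq_iff[OF assms(1,2)])
    qed
    show "g 0 = n" by (simp add: g_def)
  qed (rule g)
qed

lemma ratio_free_image:
  assumes "0 < r" and "r < s" and "0 < n"
    and g: "\<And>k. k \<in> K \<Longrightarrow> g k * s ^ k = n * r ^ k"
  shows "ratio_free E r s (g ` K) \<longleftrightarrow> gap_free E K"
proof -
  have *: "g i * s ^ e = g j * r ^ e \<longleftrightarrow> i = j + e" if "i \<in> K" "j \<in> K" for i j e
  proof -
    \<comment> \<open>Multiplying by \<open>s ^ i * s ^ j\<close> allows both values of
      \<open>g\<close> to be replaced by their defining equations.\<close>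
    have "g i * s ^ e * (s ^ i * s ^ j) = (g i * s ^ i) * s ^ (j + e)"
      by (simp only: power_add mult_ac)
    also have "\<dots> = n * (r ^ i * s ^ (j + e))" by (simp only: g[OF that(1)] mult.assoc)
    finally have "g i * s ^ e * (s ^ i * s ^ j) = n * (r ^ i * s ^ (j + e))" .
    moreover have "g j * r ^ e * (s ^ i * s ^ j) = (g j * s ^ j) * r ^ e * s ^ i"
      by (simp only: mult_ac)
    then have "g j * r ^ e * (s ^ i * s ^ j) = n * (r ^ (j + e) * s ^ i)"
      by (simp only: g[OF that(2)] power_add mult.assoc)
    moreover have "g i * s ^ e = g j * r ^ e \<longleftrightarrow>
      g i * s ^ e * (s ^ i * s ^ j) = g j * r ^ e * (s ^ i * s ^ j)"
      by (subst mult_cancel2) (use assms(1,2) in auto)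
    ultimately have "g i * s ^ e = g j * r ^ e \<longleftrightarrow>
      n * (r ^ i * s ^ (j + e)) = n * (r ^ (j + e) * s ^ i)"
      by (simp only:)
    also have "\<dots> \<longleftrightarrow> i = j + e"
      unfolding mult_cancel1 ratio_powers_eq_iff[OF assms(1,2)] using assms(3) by simp
    finally show ?thesis .
  qed
  have "ratio_free E r s (g ` K) \<longleftrightarrow> (\<forall>e\<in>E. \<forall>i\<in>K. \<forall>j\<in>K. g i * s ^ e \<noteq> g j * r ^ e)"
    by (simp add: ratio_free_def)
  also have "\<dots> \<longleftrightarrow> (\<forall>e\<in>E. \<forall>i\<in>K. \<forall>j\<in>K. i \<noteq> j + e)"
    by (intro ball_cong refl) (simp only: *)
  also have "\<dots> \<longleftrightarrow> gap_free E K" unfolding gap_free_def by blast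
  finally show ?thesis .
qed

section \<open>Induction on \<open>n\<close>\<close>

text \<open>Outside the chain of \<open>Suc n\<close>, both intervals have the same part
  \<open>R\<close>, independent of the chain. Eliminating its common factor gives the multiplied-out
  identity.\<close>

lemma bern_sum_ratio_free_Suc:
  fixes n r s :: nat
  assumes "0 < r" and "r < s" and "coprime r s"
  defines "v \<equiv> multiplicity s (Suc n)"
  shows "bern_sum \<alpha> {1..Suc n} (ratio_free E r s) * gap_weight E \<alpha> {} v =
    bern_sum \<alpha> {1..n} (ratio_free E r s) * gap_weight E \<alpha> {} (Suc v)"
proof -
  let ?C = "ratio_chain r s (Suc n)" and ?F = "ratio_free E r s"
  obtain g where C: "?C = g ` {..v}" and inj: "inj_on g {..v}" and g0: "g 0 = Suc n"
    and g: "\<And>k. k \<le> v \<Longrightarrow> g k * s ^ k = Suc n * r ^ k"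
    using ratio_chain_conv_image[OF assms(1-3), of "Suc n"] unfolding v_def by auto
  have sub: "?C \<subseteq> {1..Suc n}"
  proof
    fix x assume "x \<in> ?C"
    then obtain k where k: "x * s ^ k = Suc n * r ^ k" by (auto simp: ratio_chain_def)
    have "x \<noteq> 0" using k assms(1) by (auto intro!: gr0I)
    moreover have "Suc n * r ^ k \<le> Suc n * s ^ k"
      using assms(2) by (intro mult_left_mono power_mono) auto
    then have "x * s ^ k \<le> Suc n * s ^ k" by (simp only: k)
    then have "x \<le> Suc n" unfolding mult_le_cancel2 using assms(2) by auto
    ultimately show "x \<in> {1..Suc n}" by simp
  qed
  have chain: "bern_sum \<alpha> (g ` K) ?F = bern_sum \<alpha> K (gap_free E)" if "K \<subseteq> {..v}" for K
  proof (subst bern_sum_image)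
    show "finite K" using that finite_subset by blast
    show "inj_on g K" using inj that inj_on_subset by blast
    have "?F (g ` B) \<longleftrightarrow> gap_free E B" if "B \<subseteq> K" for B
    proof (rule ratio_free_image[OF assms(1,2), of "Suc n"])
      fix k assume "k \<in> B"
      then have "k \<le> v" using that \<open>K \<subseteq> {..v}\<close> by auto
      then show "g k * s ^ k = Suc n * r ^ k" by (rule g)
    qed simp
    then show "bern_sum \<alpha> K (\<lambda>B. ?F (g ` B)) = bern_sum \<alpha> K (gap_free E)"
      by (intro bern_sum_cong) auto
  qed
  define R where "R = {1..Suc n} - ?C"
  \<comment> \<open>Used for \<open>K\<close> the whole chain and for the chain without its top
    \<open>Suc n\<close>.\<close>
  have split: "bern_sum \<alpha> (K \<union> R) ?F = bern_sum \<alpha> K ?F * bern_sum \<alpha> R ?F" if "K \<subseteq> ?C" for K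
  proof -
    have "bern_sum \<alpha> (K \<union> R) ?F = bern_sum \<alpha> (K \<union> R) (\<lambda>B. ?F (B \<inter> K) \<and> ?F (B \<inter> R))"
    proof (rule bern_sum_cong[OF refl])
      fix B assume "B \<subseteq> K \<union> R"
      then have "B \<inter> K = B \<inter> ?C" "B \<inter> R = B - ?C" "B \<subseteq> {1..Suc n}"
        using that sub unfolding R_def by blast+
      then show "?F B \<longleftrightarrow> ?F (B \<inter> K) \<and> ?F (B \<inter> R)"
        using ratio_free_split[OF assms(1,2), of B "Suc n"] by simp
    qed
    also have "\<dots> = bern_sum \<alpha> K ?F * bern_sum \<alpha> R ?F"
    proof (rule bern_sum_Un_disjoint)
      show "finite K" using subset_trans[OF that sub] by (rule finite_subset) simp
      show "K \<inter> R = {}" using that unfolding R_def by blast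
    qed (simp add: R_def)
    finally show ?thesis .
  qed
  have n: "Suc n \<in> ?C" unfolding C unfolding g0[symmetric] by (rule imageI) simp
  have v0: "{..v} - {0} = {1..v}" by auto
  \<comment> \<open>The top has exponent \<open>0\<close>, so \<open>v\<close> consecutive exponents
    remain.\<close>
  have C': "?C - {Suc n} = g ` {1..v}"
    unfolding C unfolding g0[symmetric] v0[symmetric]
    using inj by (subst inj_on_image_set_diff[of g "{..v}"]) auto
  have "{1..Suc n} = ?C \<union> R" using sub unfolding R_def by blast
  moreover have "{1..n} = {1..Suc n} - {Suc n}" by auto
  moreover have "\<dots> = (?C - {Suc n}) \<union> R" using sub n unfolding R_def by blast
  ultimately have "bern_sum \<alpha> {1..Suc n} ?F = bern_sum \<alpha> ?C ?F * bern_sum \<alpha> R ?F"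
    "bern_sum \<alpha> {1..n} ?F = bern_sum \<alpha> (?C - {Suc n}) ?F * bern_sum \<alpha> R ?F"
    using split[of ?C] split[of "?C - {Suc n}"] by auto
  moreover have "bern_sum \<alpha> ?C ?F = gap_weight E \<alpha> {} (Suc v)"
    unfolding C by (subst chain) (auto simp: gap_weight_def lessThan_Suc_atMost)
  moreover have "bern_sum \<alpha> (?C - {Suc n}) ?F = gap_weight E \<alpha> {} v"
    unfolding C' by (subst chain) (auto simp only: bern_sum_gap_free_atLeastAtMost atLeastAtMost_iff)
  ultimately show ?thesis by simp
qed

text \<open>Any \<open>N\<close> with \<open>n < s ^ Suc N\<close> is allowed, so the range of the
  product stays fixed while \<open>n\<close> grows.\<close>

lemma bern_sum_ratio_free:
  assumes "0 < \<alpha>" and "\<alpha> < 1" and "0 \<notin> E"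
    and "0 < r" and "r < s" and "coprime r s" and "n < s ^ Suc N"
  shows "bern_sum \<alpha> {1..n} (ratio_free E r s) =
    (\<Prod>i=1..N. gamma_seq (gap_weight E \<alpha> {}) i ^ (n div s ^ i))"
  using assms(7)
proof (induction n)
  case 0
  show ?case by (simp add: bern_sum_empty ratio_free_def)
next
  case (Suc n)
  let ?\<beta> = "gap_weight E \<alpha> {}" and ?v = "multiplicity s (Suc n)"
  have pos: "?\<beta> i \<noteq> 0" for i using gap_weight_pos[OF assms(1,2), of E "{}" i] by simp
  have "?\<beta> 0 = ?\<beta> 1" by (simp add: gap_weight_0 gap_weight_Suc[OF assms(3)])
  then have tel: "(\<Prod>i=1..?v. gamma_seq ?\<beta> i) = ?\<beta> (Suc ?v) / ?\<beta> ?v"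
    using pos by (intro prod_gamma_seq) auto
  have dvd: "s ^ k dvd Suc n \<longleftrightarrow> k \<le> ?v" for k
    using assms(4,5) by (intro power_dvd_iff_le_multiplicity) auto
  \<comment> \<open>Hence every new factor falls within the range \<open>1..N\<close>.\<close>
  have "?v \<le> N"
  proof (rule ccontr)
    assume "\<not> ?v \<le> N"
    then have "s ^ Suc N dvd Suc n" unfolding dvd by linarith
    then show False using Suc.prems dvd_imp_le[of "s ^ Suc N" "Suc n"] by linarith
  qed
  have div: "Suc n div s ^ i = (if i \<le> ?v then Suc (n div s ^ i) else n div s ^ i)" for i
    unfolding dvd[symmetric] dvd_eq_mod_eq_0 by (rule div_Suc)
  have "(\<Prod>i=1..N. gamma_seq ?\<beta> i ^ (Suc n div s ^ i)) =
    (\<Prod>i=1..N. gamma_seq ?\<beta> i ^ (n div s ^ i)) * (\<Prod>i=1..N. if i \<le> ?v then gamma_seq ?\<beta> i else 1)"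
    unfolding prod.distrib[symmetric] by (intro prod.cong) (simp_all add: div)
  also have "(\<Prod>i=1..N. if i \<le> ?v then gamma_seq ?\<beta> i else 1) = (\<Prod>i=1..?v. gamma_seq ?\<beta> i)"
    using \<open>?v \<le> N\<close> by (intro prod.mono_neutral_cong_right) auto
  also have "(\<Prod>i=1..N. gamma_seq ?\<beta> i ^ (n div s ^ i)) * (\<Prod>i=1..?v. gamma_seq ?\<beta> i) =
    bern_sum \<alpha> {1..n} (ratio_free E r s) * ?\<beta> (Suc ?v) / ?\<beta> ?v"
    unfolding tel using Suc.IH Suc.prems by simp
  also have "\<dots> = bern_sum \<alpha> {1..Suc n} (ratio_free E r s)"
    unfolding bern_sum_ratio_free_Suc[OF assms(4-6), symmetric] using pos by simp
  finally show ?case ..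
qed

section \<open>The logarithmic bound and the final assembly\<close>

lemma less_power_Suc_floor_ln:
  fixes n s :: nat
  assumes "1 \<le> n" and "1 < s"
  shows "n < s ^ Suc (nat \<lfloor>ln (real n) / ln (real s)\<rfloor>)"
proof -
  define N where "N = nat \<lfloor>ln (real n) / ln (real s)\<rfloor>"
  have s: "0 < ln (real s)" using assms by simp
  have "ln (real n) / ln (real s) < real (Suc N)" unfolding N_def by linarith
  then have "ln (real n) < ln (real s ^ Suc N)"
    using s assms by (subst ln_realpow) (auto simp: field_simps)
  then have "real n < real s ^ Suc N" using assms by (subst (asm) ln_less_cancel_iff) auto
  then have "real n < real (s ^ Suc N)" by simp
  then show ?thesis unfolding N_def by (simp only: of_nat_less_iff)
qed

theorem theorem1p3:
  fixes \<alpha> :: real and E :: "nat set"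
  assumes "0 < \<alpha>" and "\<alpha> < 1"
    and "E \<subseteq> {1..}"
    and "finite E \<or> finite ({1..} - E)"
    and "1 \<in> E"
  shows "\<exists>\<beta> :: nat \<Rightarrow> real.
      linear_recurrence \<beta> \<and>
      (\<forall>i\<ge>1. \<beta> i \<noteq> 0) \<and>
      (\<forall>n r s :: nat. 1 \<le> n \<and> 1 \<le> r \<and> r < s \<and> gcd r s = 1 \<longrightarrow>
         measure_pmf.prob (random_subset_pmf n \<alpha>)
           {A. \<exists>e\<in>E. (of_nat r / of_nat s :: rat) ^ e \<in> ratio_set A}
         = 1 - (\<Prod>i = 1..nat \<lfloor>ln (real n) / ln (real s)\<rfloor>. gamma_seq \<beta> i ^ nat \<lfloor>real n / real s ^ i\<rfloor>)) \<and>
      (finite ({1..} - E) \<longrightarrow>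
         (\<exists>p q :: real poly. q \<noteq> 0 \<and>
            (\<forall>\<^sub>F i in sequentially. gamma_seq \<beta> i = poly p (real i) / poly q (real i))))"
proof -
  let ?\<beta> = "gap_weight E \<alpha> {}"
  have E0: "0 \<notin> E" using assms(3) by auto
  have bound: "\<exists>M. E \<subseteq> {..M}" if "finite E" using that unfolding finite_nat_set_iff_bounded_le by auto
  have cobound: "\<exists>M. {M<..} \<subseteq> E" if cofin: "finite ({1..} - E)"
  proof -
    obtain M where M: "\<forall>x\<in>{1..} - E. x \<le> M" using cofin unfolding finite_nat_set_iff_bounded_le by blast
    have "{M<..} \<subseteq> E"
    proof
      fix x assume "x \<in> {M<..}"
      then have "\<not> x \<le> M" "1 \<le> x" by auto
      with M show "x \<in> E" by blast
    qed
    then show ?thesis ..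
  qed
  obtain M where "E \<subseteq> {..M} \<or> {M<..} \<subseteq> E" using assms(4) bound cobound by blast
  then have rec: "linear_recurrence ?\<beta>" by (rule linear_recurrence_gap_weight[OF E0])
  have nonzero: "?\<beta> i \<noteq> 0" for i using gap_weight_pos[OF assms(1,2), of E "{}" i] by simp
  have prob: "measure_pmf.prob (random_subset_pmf n \<alpha>)
           {A. \<exists>e\<in>E. (of_nat r / of_nat s :: rat) ^ e \<in> ratio_set A}
         = 1 - (\<Prod>i = 1..nat \<lfloor>ln (real n) / ln (real s)\<rfloor>. gamma_seq ?\<beta> i ^ nat \<lfloor>real n / real s ^ i\<rfloor>)"
    if "1 \<le> n" "1 \<le> r" "r < s" "gcd r s = 1" for n r s :: nat
  proof -
    let ?p = "random_subset_pmf n \<alpha>" and ?X = "{A. \<exists>e\<in>E. (of_nat r / of_nat s :: rat) ^ e \<in> ratio_set A}"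
    let ?N = "nat \<lfloor>ln (real n) / ln (real s)\<rfloor>"
    have "measure_pmf.prob ?p ?X = 1 - measure_pmf.prob ?p {A. A \<notin> ?X}"
    proof -
      have "{A. A \<notin> ?X} = space ?p - ?X" by auto
      then show ?thesis using measure_pmf.prob_compl[of ?X ?p] by simp
    qed
    also have "measure_pmf.prob ?p {A. A \<notin> ?X} = bern_sum \<alpha> {1..n} (\<lambda>A. A \<notin> ?X)"
      using assms(1,2) by (intro prob_random_subset) auto
    also have "\<dots> = bern_sum \<alpha> {1..n} (ratio_free E r s)"
    \<comment> \<open>Subsets of \<open>{1..n}\<close> avoid \<open>0\<close>, so the ratios can be
      cross-multiplied.\<close>
    proof (rule bern_sum_cong[OF refl])
      fix B assume "B \<subseteq> {1..n}"
      then have "0 \<notin> B" by auto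
      then show "B \<notin> ?X \<longleftrightarrow> ratio_free E r s B" using that by (simp add: ratio_free_iff)
    qed
    also have "\<dots> = (\<Prod>i=1..?N. gamma_seq ?\<beta> i ^ (n div s ^ i))"
      using that assms(1,2) E0 by (intro bern_sum_ratio_free less_power_Suc_floor_ln) (auto simp: coprime_iff_gcd_eq_1)
    \<comment> \<open>The floor of the real quotient is the natural quotient
      \<open>n div s ^ i\<close>.\<close>
    also have "\<dots> = (\<Prod>i=1..?N. gamma_seq ?\<beta> i ^ nat \<lfloor>real n / real s ^ i\<rfloor>)"
      by (intro prod.cong refl) (simp add: floor_divide_of_nat_eq of_nat_power[symmetric] del: of_nat_power)
    finally show ?thesis .
  qed
  have rational: "\<exists>p q :: real poly. q \<noteq> 0 \<and>
      (\<forall>\<^sub>F i in sequentially. gamma_seq ?\<beta> i = poly p (real i) / poly q (real i))"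
    if cofin: "finite ({1..} - E)"
  proof -
    obtain M where "{M<..} \<subseteq> E" using cobound[OF cofin] by blast
    from gap_weight_cofinite_gaps[OF assms(1,2) E0 this] obtain b c
      where "0 < b" "0 < c" "\<And>j. ?\<beta> (M + j) = (1 - \<alpha>) ^ j * (b + real j * c)" by metis
    then show ?thesis using assms(2) by (intro gamma_seq_rational[of "1 - \<alpha>" b c _ M]) auto
  qed
  show ?thesis
    by (intro exI[of _ ?\<beta>] conjI allI impI; (elim conjE)?)
      (rule rec nonzero prob rational; assumption)+
qed

end
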